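(* Let $\mathcal{H}$ be a complex Hilbert space with inner product $\langle\cdot,\cdot\rangle$ and norm $\|\cdot\|$. For any $x,y,z\in\mathcal{H}$, \[ \begin{aligned} &|\langle x,z\rangle\langle z,y\rangle|\\ &\le \frac12\Big[|\langle x,z\rangle\langle y,z\rangle|+|\langle x,y\rangle|\,\|z\|^2+\big|\langle x,y\rangle\|z\|^2-\langle x,z\rangle\langle z,y\rangle\big|\Big]\\ &\le \frac12\Big[|\langle x,z\rangle\langle y,z\rangle|+|\langle x,y\rangle|\,\|z\|^2+\sqrt{\|x\|^2\|z\|^2-|\langle x,z\rangle|^2}\,\sqrt{\|y\|^2\|z\|^2-|\langle y,z\rangle|^2}\Big]\\ &\le \frac{\|z\|^2}{2}\big(\|x\|\,\|y\|+|\langle x,y\rangle|\big). \end{aligned} \] *)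

theory Defs
  imports Complex_Main
begin

class complex_vector = real_vector +
  fixes scaleC :: "complex \<Rightarrow> 'a \<Rightarrow> 'a"  (infixr "*\<^sub>C" 75)
  assumes scaleC_add_right: "a *\<^sub>C (x + y) = a *\<^sub>C x + a *\<^sub>C y"
    and scaleC_add_left: "(a + b) *\<^sub>C x = a *\<^sub>C x + b *\<^sub>C x"
    and scaleC_scaleC: "a *\<^sub>C (b *\<^sub>C x) = (a * b) *\<^sub>C x"
    and scaleC_one: "1 *\<^sub>C x = x"
    and scaleR_scaleC: "r *\<^sub>R x = complex_of_real r *\<^sub>C x"

(* The inner product is linear in the first and conjugate-linear in the second argument.
   The norm is the one induced by the inner product (norm_eq_sqrt_cinner), so the norm
   axioms inherited from real_normed_vector, the triangle inequality included, are
   consequences of the inner product axioms and restrict nothing; the superclass is there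
   to supply the metric and the topology. *)
class complex_inner = complex_vector + real_normed_vector +
  fixes cinner :: "'a \<Rightarrow> 'a \<Rightarrow> complex"  ("\<langle>_,/ _\<rangle>")
  assumes cinner_commute: "\<langle>x, y\<rangle> = cnj \<langle>y, x\<rangle>"
    and cinner_add_left: "\<langle>x + y, z\<rangle> = \<langle>x, z\<rangle> + \<langle>y, z\<rangle>"
    and cinner_scaleC_left: "\<langle>a *\<^sub>C x, y\<rangle> = a * \<langle>x, y\<rangle>"
    and cinner_ge_zero: "0 \<le> Re \<langle>x, x\<rangle>"
    and cinner_eq_zero_iff: "\<langle>x, x\<rangle> = 0 \<longleftrightarrow> x = 0"
    and norm_eq_sqrt_cinner: "norm x = sqrt (Re \<langle>x, x\<rangle>)"

class complex_hilbert_space = complex_inner + complete_space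

end

theory Submission imports Defs
begin

text \<open>
  Write \<open>u = \<langle>x, y\<rangle> \<parallel>z\<parallel>\<^sup>2\<close> and \<open>w = \<langle>x, z\<rangle> \<langle>z, y\<rangle>\<close>.  The first inequality is the triangle
  inequality \<open>\<bar>w\<bar> \<le> \<bar>u\<bar> + \<bar>u - w\<bar>\<close> in the complex plane, averaged with \<open>\<bar>w\<bar> \<le> \<bar>w\<bar>\<close>.

  For the second, remove from \<open>x\<close> and \<open>y\<close> their components along \<open>z\<close>.  With denominators
  cleared, the rejections are \<open>p = \<parallel>z\<parallel>\<^sup>2 x - \<langle>x, z\<rangle> z\<close> and \<open>q = \<parallel>z\<parallel>\<^sup>2 y - \<langle>y, z\<rangle> z\<close>.
  Since \<open>p\<close> is orthogonal to \<open>z\<close>, one finds \<open>\<langle>p, q\<rangle> = \<parallel>z\<parallel>\<^sup>2 (u - w)\<close> (lemma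
  \<open>cinner_rejection\<close>), and the case \<open>x = y\<close> gives \<open>\<parallel>p\<parallel>\<^sup>2\<close> and \<open>\<parallel>q\<parallel>\<^sup>2\<close>.  The Cauchy--Schwarz
  inequality for \<open>p\<close> and \<open>q\<close>, divided by \<open>\<parallel>z\<parallel>\<^sup>2\<close>, is the second inequality (lemma
  \<open>cmod_gram_le\<close>).

  For the third, the pairs \<open>(\<bar>\<langle>x, z\<rangle>\<bar>, sqrt (\<parallel>x\<parallel>\<^sup>2 \<parallel>z\<parallel>\<^sup>2 - \<bar>\<langle>x, z\<rangle>\<bar>\<^sup>2))\<close> and its analogue for
  \<open>y\<close> are plane vectors of lengths \<open>\<parallel>x\<parallel> \<parallel>z\<parallel>\<close> and \<open>\<parallel>y\<parallel> \<parallel>z\<parallel>\<close>, so the Cauchy--Schwarz inequality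
  in the plane (lemma \<open>mult_add_sqrt_mult_sqrt_le\<close>) bounds their dot product.
\<close>

lemma cinner_add_right: "\<langle>x, y + z\<rangle> = \<langle>x, y\<rangle> + \<langle>x, z\<rangle>"
  for x y z :: "'a :: complex_inner"
  by (metis cinner_add_left cinner_commute complex_cnj_add)

lemma cinner_scaleC_right: "\<langle>x, a *\<^sub>C y\<rangle> = cnj a * \<langle>x, y\<rangle>"
  for x y :: "'a :: complex_inner"
  by (metis cinner_scaleC_left cinner_commute complex_cnj_mult)

lemma cinner_self: "\<langle>x, x\<rangle> = complex_of_real ((norm x)\<^sup>2)"
  for x :: "'a :: complex_inner"
proof -
  have "\<langle>x, x\<rangle> = cnj \<langle>x, x\<rangle>"
    by (rule cinner_commute)
  then have "Im \<langle>x, x\<rangle> = 0"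
    by (simp add: complex_eq_iff)
  then show ?thesis
    using cinner_ge_zero[of x] by (simp add: complex_eq_iff norm_eq_sqrt_cinner)
qed

lemma cinner_zero_right [simp]: "\<langle>x, 0\<rangle> = 0"
  for x :: "'a :: complex_inner"
  using cinner_add_right[of x 0 0] by simp

lemma cmod_cinner_commute: "cmod \<langle>x, y\<rangle> = cmod \<langle>y, x\<rangle>"
  for x y :: "'a :: complex_inner"
  by (metis cinner_commute complex_mod_cnj)

text \<open>
  The factor \<open>\<parallel>z\<parallel>\<^sup>2\<close> clears the denominator of the projection coefficient
  \<open>\<langle>x, z\<rangle> / \<parallel>z\<parallel>\<^sup>2\<close>, so that the identities below hold for \<open>z = 0\<close> as well.
\<close>
definition rejection :: "'a \<Rightarrow> 'a \<Rightarrow> 'a :: complex_inner" where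
  "rejection z x = complex_of_real ((norm z)\<^sup>2) *\<^sub>C x + (- \<langle>x, z\<rangle>) *\<^sub>C z"

lemma cinner_rejection:
  fixes x y z :: "'a :: complex_inner"
  shows "\<langle>rejection z x, rejection z y\<rangle> = complex_of_real ((norm z)\<^sup>2) *
           (\<langle>x, y\<rangle> * complex_of_real ((norm z)\<^sup>2) - \<langle>x, z\<rangle> * \<langle>z, y\<rangle>)"
proof -
  have "cnj \<langle>y, z\<rangle> = \<langle>z, y\<rangle>"
    by (rule cinner_commute[symmetric])
  then show ?thesis
    by (simp add: rejection_def cinner_add_left cinner_add_right cinner_scaleC_left
        cinner_scaleC_right cinner_self[of z] algebra_simps)
qed

lemma norm_rejection_squared:
  fixes x z :: "'a :: complex_inner"
  shows "(norm (rejection z x))\<^sup>2 =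
           (norm z)\<^sup>2 * ((norm x)\<^sup>2 * (norm z)\<^sup>2 - (cmod \<langle>x, z\<rangle>)\<^sup>2)"
proof -
  have "\<langle>x, z\<rangle> * \<langle>z, x\<rangle> = complex_of_real ((cmod \<langle>x, z\<rangle>)\<^sup>2)"
    by (metis cinner_commute complex_norm_square)
  then have "complex_of_real ((norm (rejection z x))\<^sup>2) = complex_of_real
      ((norm z)\<^sup>2 * ((norm x)\<^sup>2 * (norm z)\<^sup>2 - (cmod \<langle>x, z\<rangle>)\<^sup>2))"
    using cinner_rejection[of z x x] by (simp add: cinner_self)
  then show ?thesis
    by (simp only: of_real_eq_iff)
qed

text \<open>
  The Cauchy--Schwarz inequality: the squared norm of the rejection of \<open>x\<close> from \<open>z\<close> is
  nonnegative.
\<close>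
lemma cmod_cinner_squared_le: "(cmod \<langle>x, z\<rangle>)\<^sup>2 \<le> (norm x)\<^sup>2 * (norm z)\<^sup>2"
  for x z :: "'a :: complex_inner"
proof (cases "z = 0")
  case False
  have "0 \<le> (norm z)\<^sup>2 * ((norm x)\<^sup>2 * (norm z)\<^sup>2 - (cmod \<langle>x, z\<rangle>)\<^sup>2)"
    by (metis norm_rejection_squared zero_le_power2)
  with False show ?thesis
    by (simp add: zero_le_mult_iff)
qed simp

text \<open>
  Cauchy--Schwarz for the two rejections.  Both sides of that inequality carry the factor
  \<open>\<parallel>z\<parallel>\<^sup>2\<close>, which cancels unless \<open>z = 0\<close>.
\<close>
lemma cmod_gram_le:
  fixes x y z :: "'a :: complex_inner"
  shows "cmod (\<langle>x, y\<rangle> * complex_of_real ((norm z)\<^sup>2) - \<langle>x, z\<rangle> * \<langle>z, y\<rangle>)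
           \<le> sqrt ((norm x)\<^sup>2 * (norm z)\<^sup>2 - (cmod \<langle>x, z\<rangle>)\<^sup>2)
             * sqrt ((norm y)\<^sup>2 * (norm z)\<^sup>2 - (cmod \<langle>y, z\<rangle>)\<^sup>2)"
    (is "cmod ?d \<le> sqrt ?X * sqrt ?Y")
proof (cases "z = 0")
  case False
  let ?N = "(norm z)\<^sup>2"
  have "cmod \<langle>rejection z x, rejection z y\<rangle> = ?N * cmod ?d"
    by (simp add: cinner_rejection norm_mult norm_power)
  then have "(?N * cmod ?d)\<^sup>2 \<le> (?N * ?X) * (?N * ?Y)"
    using cmod_cinner_squared_le[of "rejection z x" "rejection z y"]
    by (simp only: norm_rejection_squared)
  then have "?N\<^sup>2 * (cmod ?d)\<^sup>2 \<le> ?N\<^sup>2 * (?X * ?Y)"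
    by (simp add: power_mult_distrib power2_eq_square mult_ac)
  with False have "(cmod ?d)\<^sup>2 \<le> ?X * ?Y"
    by (subst (asm) mult_le_cancel_left_pos) simp_all
  then have "cmod ?d \<le> sqrt (?X * ?Y)"
    by (rule real_le_rsqrt)
  then show ?thesis
    by (simp add: real_sqrt_mult)
qed simp

text \<open>
  The dot product of the plane vectors \<open>(a, sqrt (A\<^sup>2 - a\<^sup>2))\<close> and \<open>(b, sqrt (B\<^sup>2 - b\<^sup>2))\<close> is at
  most the product \<open>A B\<close> of their lengths.
\<close>
lemma mult_add_sqrt_mult_sqrt_le:
  fixes a b A B :: real
  assumes "a\<^sup>2 \<le> A\<^sup>2" "b\<^sup>2 \<le> B\<^sup>2" "0 \<le> A" "0 \<le> B"
  shows "a * b + sqrt (A\<^sup>2 - a\<^sup>2) * sqrt (B\<^sup>2 - b\<^sup>2) \<le> A * B"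
proof -
  define s t where "s = sqrt (A\<^sup>2 - a\<^sup>2)" and "t = sqrt (B\<^sup>2 - b\<^sup>2)"
  have "A\<^sup>2 = a\<^sup>2 + s\<^sup>2" "B\<^sup>2 = b\<^sup>2 + t\<^sup>2"
    using assms by (simp_all add: s_def t_def)
  then have "(A * B)\<^sup>2 = (a * b + s * t)\<^sup>2 + (a * t - b * s)\<^sup>2"
    unfolding power_mult_distrib by algebra
  then have "(a * b + s * t)\<^sup>2 \<le> (A * B)\<^sup>2"
    by simp
  then have "a * b + s * t \<le> A * B"
    by (rule power2_le_imp_le) (simp add: assms)
  then show ?thesis
    by (simp add: s_def t_def)
qed

theorem lemma2p1:
  fixes x y z :: "'a :: complex_hilbert_space"
  shows
    "cmod (\<langle>x, z\<rangle> * \<langle>z, y\<rangle>)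
       \<le> 1 / 2 * (cmod (\<langle>x, z\<rangle> * \<langle>y, z\<rangle>) + cmod \<langle>x, y\<rangle> * (norm z)\<^sup>2
           + cmod (\<langle>x, y\<rangle> * complex_of_real ((norm z)\<^sup>2) - \<langle>x, z\<rangle> * \<langle>z, y\<rangle>))
     \<and> 1 / 2 * (cmod (\<langle>x, z\<rangle> * \<langle>y, z\<rangle>) + cmod \<langle>x, y\<rangle> * (norm z)\<^sup>2
           + cmod (\<langle>x, y\<rangle> * complex_of_real ((norm z)\<^sup>2) - \<langle>x, z\<rangle> * \<langle>z, y\<rangle>))
       \<le> 1 / 2 * (cmod (\<langle>x, z\<rangle> * \<langle>y, z\<rangle>) + cmod \<langle>x, y\<rangle> * (norm z)\<^sup>2
           + sqrt ((norm x)\<^sup>2 * (norm z)\<^sup>2 - (cmod \<langle>x, z\<rangle>)\<^sup>2)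
             * sqrt ((norm y)\<^sup>2 * (norm z)\<^sup>2 - (cmod \<langle>y, z\<rangle>)\<^sup>2))
     \<and> 1 / 2 * (cmod (\<langle>x, z\<rangle> * \<langle>y, z\<rangle>) + cmod \<langle>x, y\<rangle> * (norm z)\<^sup>2
           + sqrt ((norm x)\<^sup>2 * (norm z)\<^sup>2 - (cmod \<langle>x, z\<rangle>)\<^sup>2)
             * sqrt ((norm y)\<^sup>2 * (norm z)\<^sup>2 - (cmod \<langle>y, z\<rangle>)\<^sup>2))
       \<le> (norm z)\<^sup>2 / 2 * (norm x * norm y + cmod \<langle>x, y\<rangle>)"
proof (intro conjI)
  let ?u = "\<langle>x, y\<rangle> * complex_of_real ((norm z)\<^sup>2)" and ?w = "\<langle>x, z\<rangle> * \<langle>z, y\<rangle>"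
  let ?a = "cmod \<langle>x, z\<rangle>" and ?b = "cmod \<langle>y, z\<rangle>"
  have w: "cmod ?w = cmod (\<langle>x, z\<rangle> * \<langle>y, z\<rangle>)"
    by (simp add: norm_mult cmod_cinner_commute[of z y])
  have u: "cmod ?u = cmod \<langle>x, y\<rangle> * (norm z)\<^sup>2"
    by (simp add: norm_mult norm_power)
  have "cmod ?w \<le> cmod ?u + cmod (?u - ?w)"
    using norm_triangle_ineq4[of ?u "?u - ?w"] by simp
  then have "cmod ?w \<le> 1 / 2 * (cmod ?w + cmod ?u + cmod (?u - ?w))"
    by argo
  then show "cmod ?w \<le> 1 / 2 * (cmod (\<langle>x, z\<rangle> * \<langle>y, z\<rangle>) + cmod \<langle>x, y\<rangle> * (norm z)\<^sup>2
      + cmod (?u - ?w))"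
    by (simp only: w u)
  show "1 / 2 * (cmod (\<langle>x, z\<rangle> * \<langle>y, z\<rangle>) + cmod \<langle>x, y\<rangle> * (norm z)\<^sup>2 + cmod (?u - ?w))
      \<le> 1 / 2 * (cmod (\<langle>x, z\<rangle> * \<langle>y, z\<rangle>) + cmod \<langle>x, y\<rangle> * (norm z)\<^sup>2
        + sqrt ((norm x)\<^sup>2 * (norm z)\<^sup>2 - ?a\<^sup>2) * sqrt ((norm y)\<^sup>2 * (norm z)\<^sup>2 - ?b\<^sup>2))"
    by (intro mult_left_mono add_left_mono cmod_gram_le) simp
  have "?a * ?b + sqrt ((norm x)\<^sup>2 * (norm z)\<^sup>2 - ?a\<^sup>2) * sqrt ((norm y)\<^sup>2 * (norm z)\<^sup>2 - ?b\<^sup>2)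
      \<le> (norm x * norm z) * (norm y * norm z)"
    using mult_add_sqrt_mult_sqrt_le[of ?a "norm x * norm z" ?b "norm y * norm z"]
      cmod_cinner_squared_le[of x z] cmod_cinner_squared_le[of y z]
    by (simp add: power_mult_distrib)
  then show "1 / 2 * (cmod (\<langle>x, z\<rangle> * \<langle>y, z\<rangle>) + cmod \<langle>x, y\<rangle> * (norm z)\<^sup>2
        + sqrt ((norm x)\<^sup>2 * (norm z)\<^sup>2 - ?a\<^sup>2) * sqrt ((norm y)\<^sup>2 * (norm z)\<^sup>2 - ?b\<^sup>2))
      \<le> (norm z)\<^sup>2 / 2 * (norm x * norm y + cmod \<langle>x, y\<rangle>)"
    by (simp add: norm_mult power2_eq_square algebra_simps)
qed

end
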